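(* Let $n_1,n_2,n_3\in\mathbb{N}_0$, let $\alpha,\beta,\gamma,\delta$ be real parameters, and put $w=1-x-y-z$. The polynomials $P_{n_1,n_2,n_3}^{(\alpha,\beta,\gamma,\delta)}$ defined in the context satisfy the following four relations on $\mathbb{T}^3$ (all polynomials evaluated at $(x,y,z)$). (1) $$\begin{aligned}&(2n_2+2n_3+\beta+\gamma+\delta+2)\left(\frac{\partial}{\partial x}-\frac{\partial}{\partial y}\right)\left(x^{\alpha}y^{\beta}z^{\gamma}w^{\delta}P_{n_1,n_2,n_3}^{(\alpha,\beta,\gamma,\delta)}\right)\\&=x^{\alpha-1}y^{\beta-1}z^{\gamma}w^{\delta}\left\{(n_1+\alpha)(n_2+1)P_{n_1,n_2+1,n_3}^{(\alpha-1,\beta-1,\gamma,\delta)}-(n_1+1)(n_2+\beta)P_{n_1+1,n_2,n_3}^{(\alpha-1,\beta-1,\gamma,\delta)}\right\};\end{aligned}$$ (2) $$\begin{aligned}&(2n_3+\gamma+\delta+1)\left(\frac{\partial}{\partial z}-\frac{\partial}{\partial y}\right)\left(x^{\alpha}y^{\beta}z^{\gamma}w^{\delta}P_{n_1,n_2,n_3}^{(\alpha,\beta,\gamma,\delta)}\right)\\&=x^{\alpha}y^{\beta-1}z^{\gamma-1}w^{\delta}\left\{-(n_2+\beta)(n_3+1)P_{n_1,n_2,n_3+1}^{(\alpha,\beta-1,\gamma-1,\delta)}+(n_2+1)(n_3+\gamma)P_{n_1,n_2+1,n_3}^{(\alpha,\beta-1,\gamma-1,\delta)}\right\};\end{aligned}$$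 (3) $$\frac{\partial}{\partial z}\left(x^{\alpha}y^{\beta}z^{\gamma}w^{\delta}P_{n_1,n_2,n_3}^{(\alpha,\beta,\gamma,\delta)}\right)=-x^{\alpha}y^{\beta}z^{\gamma-1}w^{\delta-1}(n_3+1)P_{n_1,n_2,n_3+1}^{(\alpha,\beta,\gamma-1,\delta-1)};$$ (4) $$\begin{aligned}&(2n_2+2n_3+\beta+\gamma+\delta+2)\frac{\partial}{\partial z}\left(\frac{\partial}{\partial x}-\frac{\partial}{\partial y}\right)\left(x^{\alpha}y^{\beta}z^{\gamma}w^{\delta}P_{n_1,n_2,n_3}^{(\alpha,\beta,\gamma,\delta)}\right)\\&=-x^{\alpha-1}y^{\beta-1}z^{\gamma-1}w^{\delta-1}\left\{(n_1+\alpha)(n_2+1)(n_3+1)P_{n_1,n_2+1,n_3+1}^{(\alpha-1,\beta-1,\gamma-1,\delta-1)}-(n_1+1)(n_2+\beta)(n_3+1)P_{n_1+1,n_2,n_3+1}^{(\alpha-1,\beta-1,\gamma-1,\delta-1)}\right\}.\end{aligned}$$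
   Context: Jacobi polynomials: for $n\in\mathbb{N}_0=\{0,1,2,\dots\}$ and real $p,q$, $$P_n^{(p,q)}(t)=\frac{(-1)^n}{2^n n!}(1-t)^{-p}(1+t)^{-q}\frac{d^n}{dt^n}\left\{(1-t)^{n+p}(1+t)^{n+q}\right\}$$ (a polynomial in $t$). The simplex is $\mathbb{T}^3=\{(x,y,z)\in\mathbb{R}^3: x,y,z>0,\ 1-x-y-z>0\}$. Koornwinder polynomials in three variables on the simplex: for $n_1,n_2,n_3\in\mathbb{N}_0$, $$P_{n_1,n_2,n_3}^{(\alpha,\beta,\gamma,\delta)}(x,y,z)=P_{n_1}^{(\beta+\gamma+\delta+2n_2+2n_3+2,\,\alpha)}(2x-1)\,(1-x)^{n_2}\,P_{n_2}^{(\gamma+\delta+2n_3+1,\,\beta)}\!\left(\tfrac{2y}{1-x}-1\right)(1-x-y)^{n_3}\,P_{n_3}^{(\delta,\gamma)}\!\left(\tfrac{2z}{1-x-y}-1\right).$$ *)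

theory Defs
  imports "HOL-Analysis.Analysis" "HOL-Computational_Algebra.Polynomial"
begin

text \<open>
  The Rodrigues expression, meaningful for \<open>-1 < t < 1\<close>, where both bases are positive.
\<close>

definition jacobi_rodrigues :: "nat \<Rightarrow> real \<Rightarrow> real \<Rightarrow> real \<Rightarrow> real" where
  "jacobi_rodrigues n p q t =
     (-1) ^ n / (2 ^ n * fact n) * (1 - t) powr (-p) * (1 + t) powr (-q) *
     (deriv ^^ n) (\<lambda>s. (1 - s) powr (real n + p) * (1 + s) powr (real n + q)) t"

text \<open>
  The Jacobi polynomial is the unique polynomial given by the Rodrigues expression on \<open>(-1, 1)\<close>.
\<close>

definition jacobi :: "nat \<Rightarrow> real \<Rightarrow> real \<Rightarrow> real poly" where
  "jacobi n p q = (THE P. \<forall>t\<in>{-1<..<1}. poly P t = jacobi_rodrigues n p q t)"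

lemma higher_deriv_powr_powr:
  fixes a b :: real
  shows "\<exists>Q. \<forall>t\<in>{-1<..<1}. (deriv ^^ k) (\<lambda>s. (1 - s) powr a * (1 + s) powr b) t =
           (1 - t) powr (a - real k) * (1 + t) powr (b - real k) * poly Q t"
proof (induction k)
  case 0
  have "\<forall>t\<in>{-1<..<1}. (deriv ^^ 0) (\<lambda>s. (1 - s) powr a * (1 + s) powr b) t =
          (1 - t) powr (a - real 0) * (1 + t) powr (b - real 0) * poly 1 t"
    by simp
  then show ?case by blast
next
  case (Suc k)
  define f where "f = (\<lambda>s::real. (1 - s) powr a * (1 + s) powr b)"
  obtain Q where Q: "\<And>t. t \<in> {-1<..<1} \<Longrightarrow> (deriv ^^ k) f t =
      (1 - t) powr (a - real k) * (1 + t) powr (b - real k) * poly Q t"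
    using Suc unfolding f_def by blast
  define A where "A = a - real k"
  define B where "B = b - real k"
  define R where "R = [:-A, -A:] * Q + [:B, -B:] * Q + [:1, 0, -1:] * pderiv Q"
  have "(deriv ^^ Suc k) f t =
      (1 - t) powr (a - real (Suc k)) * (1 + t) powr (b - real (Suc k)) * poly R t"
    if t: "t \<in> {-1<..<1}" for t
  proof -
    have pos: "0 < 1 - t" "0 < 1 + t" using t by auto
    have 1: "(1 - t) powr A = (1 - t) powr (A - 1) * (1 - t)"
      and 2: "(1 + t) powr B = (1 + t) powr (B - 1) * (1 + t)"
      using pos by (simp_all add: powr_diff)
    have "((\<lambda>s. (1 - s) powr A * (1 + s) powr B * poly Q s) has_real_derivative
        ((- A * (1 - t) powr (A - 1)) * (1 + t) powr B +
         (1 - t) powr A * (B * (1 + t) powr (B - 1))) * poly Q t +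
        (1 - t) powr A * (1 + t) powr B * poly (pderiv Q) t) (at t)"
      using pos by (auto intro!: derivative_eq_intros simp: algebra_simps)
    also have "((- A * (1 - t) powr (A - 1)) * (1 + t) powr B +
         (1 - t) powr A * (B * (1 + t) powr (B - 1))) * poly Q t +
        (1 - t) powr A * (1 + t) powr B * poly (pderiv Q) t =
        (1 - t) powr (A - 1) * (1 + t) powr (B - 1) * poly R t"
      unfolding 1 2 R_def by (simp add: algebra_simps)
    finally have D: "((\<lambda>s. (1 - s) powr A * (1 + s) powr B * poly Q s) has_real_derivative
        (1 - t) powr (A - 1) * (1 + t) powr (B - 1) * poly R t) (at t)" .
    have "((deriv ^^ k) f has_real_derivative
        (1 - t) powr (A - 1) * (1 + t) powr (B - 1) * poly R t) (at t)"
      by (rule has_field_derivative_transform_within_open[OF D, of "{-1<..<1}"])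
         (use t Q in \<open>auto simp: A_def B_def\<close>)
    then have "deriv ((deriv ^^ k) f) t =
        (1 - t) powr (A - 1) * (1 + t) powr (B - 1) * poly R t"
      by (rule DERIV_imp_deriv)
    then show ?thesis by (simp add: A_def B_def algebra_simps)
  qed
  then show ?case unfolding f_def by blast
qed

lemma ex1_jacobi: "\<exists>!P. \<forall>t\<in>{-1<..<1}. poly P t = jacobi_rodrigues n p q t"
proof (rule ex_ex1I)
  obtain Q where Q: "\<forall>t\<in>{-1<..<1}.
      (deriv ^^ n) (\<lambda>s. (1 - s) powr (real n + p) * (1 + s) powr (real n + q)) t =
      (1 - t) powr (real n + p - real n) * (1 + t) powr (real n + q - real n) * poly Q t"
    using higher_deriv_powr_powr by blast
  have "poly (smult ((-1) ^ n / (2 ^ n * fact n)) Q) t = jacobi_rodrigues n p q t"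
    if t: "t \<in> {-1<..<1}" for t
  proof -
    have "(1 - t) powr (-p) * (1 - t) powr p = 1" "(1 + t) powr (-q) * (1 + t) powr q = 1"
      using t by (auto simp: powr_minus)
    moreover have "jacobi_rodrigues n p q t = (-1) ^ n / (2 ^ n * fact n) *
        ((1 - t) powr (-p) * (1 - t) powr p) * ((1 + t) powr (-q) * (1 + t) powr q) * poly Q t"
      using Q t unfolding jacobi_rodrigues_def by simp
    ultimately show ?thesis by simp
  qed
  then show "\<exists>P. \<forall>t\<in>{-1<..<1}. poly P t = jacobi_rodrigues n p q t" by blast
next
  fix P Q :: "real poly"
  assume "\<forall>t\<in>{-1<..<1}. poly P t = jacobi_rodrigues n p q t"
    and "\<forall>t\<in>{-1<..<1}. poly Q t = jacobi_rodrigues n p q t"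
  then have "{-1<..<1} \<subseteq> {t. poly (P - Q) t = 0}" by auto
  moreover have "infinite {-1<..<1::real}" by simp
  ultimately have "infinite {t. poly (P - Q) t = 0}" using finite_subset by blast
  then have "P - Q = 0" using poly_roots_finite by blast
  then show "P = Q" by simp
qed

lemma poly_jacobi:
  "-1 < t \<Longrightarrow> t < 1 \<Longrightarrow> poly (jacobi n p q) t = jacobi_rodrigues n p q t"
  using theI'[OF ex1_jacobi[of n p q]] unfolding jacobi_def by auto

definition simplex3 :: "(real \<times> real \<times> real) set" where
  "simplex3 = {(x, y, z). 0 < x \<and> 0 < y \<and> 0 < z \<and> 0 < 1 - x - y - z}"

definition koornwinder ::
  "nat \<Rightarrow> nat \<Rightarrow> nat \<Rightarrow> real \<Rightarrow> real \<Rightarrow> real \<Rightarrow> real \<Rightarrow> real \<Rightarrow> real \<Rightarrow> real \<Rightarrow> real" where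
  "koornwinder n1 n2 n3 \<alpha> \<beta> \<gamma> \<delta> x y z =
     poly (jacobi n1 (\<beta> + \<gamma> + \<delta> + 2 * real n2 + 2 * real n3 + 2) \<alpha>) (2 * x - 1) *
     (1 - x) ^ n2 *
     poly (jacobi n2 (\<gamma> + \<delta> + 2 * real n3 + 1) \<beta>) (2 * y / (1 - x) - 1) *
     (1 - x - y) ^ n3 *
     poly (jacobi n3 \<delta> \<gamma>) (2 * z / (1 - x - y) - 1)"

definition simplex_weight ::
  "real \<Rightarrow> real \<Rightarrow> real \<Rightarrow> real \<Rightarrow> real \<Rightarrow> real \<Rightarrow> real \<Rightarrow> real" where
  "simplex_weight \<alpha> \<beta> \<gamma> \<delta> x y z =
     x powr \<alpha> * y powr \<beta> * z powr \<gamma> * (1 - x - y - z) powr \<delta>"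

definition partial_x :: "(real \<Rightarrow> real \<Rightarrow> real \<Rightarrow> real) \<Rightarrow> real \<Rightarrow> real \<Rightarrow> real \<Rightarrow> real" where
  "partial_x f x y z = deriv (\<lambda>s. f s y z) x"

definition partial_y :: "(real \<Rightarrow> real \<Rightarrow> real \<Rightarrow> real) \<Rightarrow> real \<Rightarrow> real \<Rightarrow> real \<Rightarrow> real" where
  "partial_y f x y z = deriv (\<lambda>s. f x s z) y"

definition partial_z :: "(real \<Rightarrow> real \<Rightarrow> real \<Rightarrow> real) \<Rightarrow> real \<Rightarrow> real \<Rightarrow> real \<Rightarrow> real" where
  "partial_z f x y z = deriv (\<lambda>s. f x y s) z"

definition weighted_koornwinder ::
  "nat \<Rightarrow> nat \<Rightarrow> nat \<Rightarrow> real \<Rightarrow> real \<Rightarrow> real \<Rightarrow> real \<Rightarrow> real \<Rightarrow> real \<Rightarrow> real \<Rightarrow> real" where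
  "weighted_koornwinder n1 n2 n3 \<alpha> \<beta> \<gamma> \<delta> x y z =
     simplex_weight \<alpha> \<beta> \<gamma> \<delta> x y z * koornwinder n1 n2 n3 \<alpha> \<beta> \<gamma> \<delta> x y z"

end

theory Submission
  imports Defs
begin

text \<open>
  Put \<open>a\<close> and \<open>b\<close> for the two pieces of a segment of length \<open>c = a + b\<close>. The polynomial
  \<open>c\<^sup>n P\<^sub>n(2a/c - 1)\<close> is a homogeneous form \<open>H\<^sub>n\<close> of degree \<open>n\<close> in \<open>a\<close> and \<open>b\<close>, with the
  explicit coefficients of \<open>jacobi_form\<close>. A Koornwinder polynomial is therefore a product of three
  such forms, one for each step of cutting the unit segment into \<open>x\<close>, \<open>y\<close>, \<open>z\<close>, \<open>w\<close>:
  first \<open>(x, 1 - x)\<close>, then \<open>(y, 1 - x - y)\<close>, then \<open>(z, w)\<close>. The factors \<open>(1 - x)\<close> and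
  \<open>(1 - x - y)\<close> in its definition only homogenize.

  Attach to each form the power of its first variable that the weight provides. For
  \<open>f(u, v) = u\<^sup>q H\<^sub>n(u, v)\<close> everything rests on three facts, which compare binomial
  coefficients. Differentiating in \<open>u\<close> alone lowers \<open>q\<close> and keeps \<open>n\<close>; moving along
  \<open>u + v = const\<close> lowers \<open>q\<close> and raises \<open>p\<close>; and two contiguous relations
  (\<open>edge_form_raise_outer\<close>, \<open>edge_form_raise_inner\<close>) exchange these results for forms of degree \<open>n + 1\<close>.
  If also the weight \<open>v\<^sup>p\<close> is attached, moving along \<open>u + v = const\<close> gives the form of degree
  \<open>n + 1\<close> outright. This is the relation for \<open>\<partial>\<^sub>z\<close>, and iterated it identifies the Rodrigues expression with \<open>H\<^sub>n\<close>.

  The relations for \<open>\<partial>\<^sub>x - \<partial>\<^sub>y\<close> and \<open>\<partial>\<^sub>z - \<partial>\<^sub>y\<close> are one statement, \<open>edge_form_ladder\<close>, about two consecutive cuts. The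
  operator \<open>\<partial>\<^sub>x - \<partial>\<^sub>y\<close> does not change \<open>1 - x - y\<close>, \<open>z\<close> or \<open>w\<close>; it moves the first cut along
  \<open>x + (1 - x) = 1\<close> and differentiates the second factor in \<open>y\<close> alone, with \<open>1 - x - y\<close>
  fixed. In the same way \<open>\<partial>\<^sub>z - \<partial>\<^sub>y\<close> fixes \<open>x\<close> and \<open>w\<close>, and acts on the second and third
  cuts. The outer parameter \<open>p\<close> of one cut is exactly \<open>2m + p + q + 1\<close> for the next one, and this is
  why the two contiguous relations fit together. The mixed
  relation applies the one for \<open>\<partial>\<^sub>z\<close> to the one for \<open>\<partial>\<^sub>x - \<partial>\<^sub>y\<close>.
\<close>

section \<open>The homogeneous Jacobi form\<close>

definition jacobi_form :: "nat \<Rightarrow> real \<Rightarrow> real \<Rightarrow> real \<Rightarrow> real \<Rightarrow> real" where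
  "jacobi_form n p q u v =
     (\<Sum>k\<le>n. ((real n + p) gchoose (n - k)) * ((real n + q) gchoose k) * u ^ (n - k) * (- v) ^ k)"

text \<open>
  The form together with the weight belonging to the edge \<open>u = 0\<close>. The weight on the edge
  \<open>v = 0\<close> is kept apart: in a weighted Koornwinder polynomial only the last cut carries one.
\<close>
definition edge_form :: "nat \<Rightarrow> real \<Rightarrow> real \<Rightarrow> real \<Rightarrow> real \<Rightarrow> real" where
  "edge_form n p q u v = u powr q * jacobi_form n p q u v"

lemma jacobi_form_homogeneous:
  "jacobi_form n p q (c * u) (c * v) = c ^ n * jacobi_form n p q u v"
proof -
  have "(c * u) ^ (n - k) * (- (c * v)) ^ k = c ^ n * (u ^ (n - k) * (- v) ^ k)" if "k \<le> n" for k
  proof -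
    have "(c * u) ^ (n - k) * (- (c * v)) ^ k = (c * u) ^ (n - k) * (c * (- v)) ^ k" by simp
    also have "\<dots> = (c ^ (n - k) * c ^ k) * (u ^ (n - k) * (- v) ^ k)"
      by (simp only: power_mult_distrib mult_ac)
    finally show ?thesis using that by (simp flip: power_add)
  qed
  then show ?thesis
    by (simp add: jacobi_form_def sum_distrib_left mult.assoc mult.left_commute[of "c ^ n"])
qed

section \<open>Contiguous relations\<close>

text \<open>
  The coefficient \<open>a gchoose (n - k)\<close>, set to zero for \<open>k > n\<close> instead of following truncated
  subtraction. Forms of degree \<open>n\<close> times a variable and forms of degree \<open>n + 1\<close> can then
  be compared term by term over the same range \<open>k \<le> n + 1\<close>.
\<close>
definition gchoose_diff :: "real \<Rightarrow> nat \<Rightarrow> nat \<Rightarrow> real" where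
  "gchoose_diff a n k = (if k \<le> n then a gchoose (n - k) else 0)"

lemma gchoose_diff_Pascal:
  assumes "k \<le> Suc n"
  shows "gchoose_diff (a + 1) (Suc n) k = gchoose_diff a (Suc n) k + gchoose_diff a n k"
proof (cases "k \<le> n")
  case True
  then show ?thesis
    using gbinomial_Suc_Suc[of a "n - k"] by (simp add: gchoose_diff_def Suc_diff_le)
next
  case False
  then show ?thesis
    using assms by (simp add: gchoose_diff_def le_Suc_eq)
qed

lemma gchoose_diff_step:
  assumes "k \<le> Suc n"
  shows "(real n + 1 - real k) * gchoose_diff a (Suc n) k =
    (a - real n + real k) * gchoose_diff a n k"
proof (cases "k \<le> n")
  case True
  then show ?thesis
    using gbinomial_mult_1[of a "n - k"]
    by (simp add: gchoose_diff_def Suc_diff_le of_nat_diff algebra_simps)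
next
  case False
  then show ?thesis
    using assms by (simp add: gchoose_diff_def le_Suc_eq)
qed

lemma gchoose_diff_absorb:
  "a * gchoose_diff (a - 1) n k = (a - real n + real k) * gchoose_diff a n k"
  using gbinomial_absorb_comp[of a "n - k"] by (simp add: gchoose_diff_def of_nat_diff algebra_simps)

lemma jacobi_form_eq:
  "jacobi_form n p q u v =
    (\<Sum>k\<le>n. gchoose_diff (real n + p) n k * ((real n + q) gchoose k) * (u ^ (n - k) * (- v) ^ k))"
  by (simp add: jacobi_form_def gchoose_diff_def mult.assoc)

text \<open>
  Lowering both parameters while raising the degree leaves the binomial arguments \<open>n + p\<close> and
  \<open>n + q\<close> unchanged, so that this form, \<open>u H\<^sub>n\<close> and \<open>v H\<^sub>n\<close> below are all expanded in the same binomials.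
\<close>
lemma jacobi_form_Suc:
  "jacobi_form (Suc n) (p - 1) (q - 1) u v = (\<Sum>k\<le>Suc n.
     gchoose_diff (real n + p) (Suc n) k * ((real n + q) gchoose k) * (u ^ (Suc n - k) * (- v) ^ k))"
proof -
  have "real (Suc n) + (p - 1) = real n + p" "real (Suc n) + (q - 1) = real n + q"
    by simp_all
  then show ?thesis
    by (simp only: jacobi_form_eq)
qed

lemma u_times_jacobi_form:
  "u * jacobi_form n p q u v = (\<Sum>k\<le>Suc n.
     gchoose_diff (real n + p) n k * ((real n + q) gchoose k) * (u ^ (Suc n - k) * (- v) ^ k))"
  by (auto simp: jacobi_form_eq gchoose_diff_def sum_distrib_left Suc_diff_le intro!: sum.cong)

text \<open>
  Multiplication by \<open>v\<close> shifts \<open>k\<close> by one. The factor \<open>n + q\<close> is what absorbs the shift into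
  the binomial and produces the factor \<open>k\<close>, which also makes the new term at \<open>k = 0\<close> vanish.
\<close>
lemma v_times_jacobi_form:
  "(real n + q) * (v * jacobi_form n p (q - 1) u v) = (\<Sum>k\<le>Suc n.
     - (real k * gchoose_diff (real n + p) (Suc n) k) * ((real n + q) gchoose k)
       * (u ^ (Suc n - k) * (- v) ^ k))"
proof -
  have absorb: "(real n + q) * ((real n + (q - 1)) gchoose k) =
      real (Suc k) * ((real n + q) gchoose Suc k)" for k
    using gbinomial_absorption[of k "real n + q"] by (simp add: add_diff_eq)
  have "(real n + q) * (v * (gchoose_diff (real n + p) n k * ((real n + (q - 1)) gchoose k) * m)) =
      v * (gchoose_diff (real n + p) n k * (real (Suc k) * ((real n + q) gchoose Suc k)) * m)" for k m
    by (simp only: absorb[symmetric] mult_ac)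
  then have "(real n + q) * (v * jacobi_form n p (q - 1) u v) =
      (\<Sum>k\<le>n. v * (gchoose_diff (real n + p) n k * (real (Suc k) * ((real n + q) gchoose Suc k))
         * (u ^ (n - k) * (- v) ^ k)))"
    by (simp only: jacobi_form_eq sum_distrib_left)
  also have "\<dots> = (\<Sum>k\<le>n. - (real (Suc k) * gchoose_diff (real n + p) (Suc n) (Suc k))
      * ((real n + q) gchoose Suc k) * (u ^ (Suc n - Suc k) * (- v) ^ Suc k))"
    by (intro sum.cong refl) (simp add: gchoose_diff_def)
  finally show ?thesis
    by (simp only: sum.atMost_Suc_shift of_nat_0 mult_zero_left minus_zero add_0_left)
qed

text \<open>
  This is the step of the Rodrigues formula freed of the weights: up to sign and powers of \<open>u\<close>, \<open>v\<close> the left side is what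
  \<open>\<partial>\<^sub>u - \<partial>\<^sub>v\<close> gives on \<open>u\<^sup>q v\<^sup>p H\<^sub>n\<close>. In the coefficients it is the splitting
  \<open>n + 1 = (n + 1 - k) + k\<close>.
\<close>
lemma jacobi_form_raise_both:
  "(real n + p) * (u * jacobi_form n (p - 1) q u v) - (real n + q) * (v * jacobi_form n p (q - 1) u v) =
     (real n + 1) * jacobi_form (Suc n) (p - 1) (q - 1) u v"
proof -
  let ?X = "gchoose_diff (real n + p) n" and ?X' = "gchoose_diff (real n + (p - 1)) n"
    and ?Y = "gchoose_diff (real n + p) (Suc n)" and ?Z = "\<lambda>k. (real n + q) gchoose k"
  have "(real n + p) * (?X' k * ?Z k * m) - - (real k * ?Y k) * ?Z k * m =
      (real n + 1) * (?Y k * ?Z k * m)" if "k \<le> Suc n" for k m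
  proof -
    have "(real n + p) * ?X' k = (real n + 1 - real k) * ?Y k"
      using gchoose_diff_absorb[of "real n + p" n k] gchoose_diff_step[OF that, of "real n + p"]
      by (simp add: add_diff_eq)
    then have "(real n + p) * ?X' k + real k * ?Y k = (real n + 1) * ?Y k"
      by (simp add: algebra_simps)
    then have "((real n + p) * ?X' k + real k * ?Y k) * (?Z k * m) = (real n + 1) * ?Y k * (?Z k * m)"
      by simp
    then show ?thesis
      by (simp add: algebra_simps)
  qed
  then show ?thesis
    unfolding u_times_jacobi_form v_times_jacobi_form jacobi_form_Suc sum_distrib_left
      sum_subtractf[symmetric]
    by (intro sum.cong refl) simp
qed

text \<open>
  The relation for the outer of two consecutive cuts: it trades the antidiagonal derivative of
  \<open>u\<^sup>q H\<^sub>n\<close> for a form of degree \<open>n + 1\<close>. After Pascal's rule for \<open>p + 1\<close> the coefficients agree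
  by \<open>gchoose_diff_step\<close>.
\<close>
lemma jacobi_form_raise_outer:
  "(real n + q) * (v * jacobi_form n (p + 1) (q - 1) u v) =
     p * (u * jacobi_form n p q u v) - (real n + 1) * jacobi_form (Suc n) (p - 1) (q - 1) u v"
proof -
  let ?X = "gchoose_diff (real n + p) n" and ?Y' = "gchoose_diff (real n + (p + 1)) (Suc n)"
    and ?Y = "gchoose_diff (real n + p) (Suc n)" and ?Z = "\<lambda>k. (real n + q) gchoose k"
  have "- (real k * ?Y' k) * ?Z k * m = p * (?X k * ?Z k * m) - (real n + 1) * (?Y k * ?Z k * m)"
    if "k \<le> Suc n" for k m
  proof -
    have "?Y' k = ?Y k + ?X k"
      using gchoose_diff_Pascal[OF that, of "real n + p"] by (simp add: add.assoc)
    then have "- (real k * ?Y' k) = p * ?X k - (real n + 1) * ?Y k"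
      using gchoose_diff_step[OF that, of "real n + p"] by (simp add: algebra_simps)
    then have "- (real k * ?Y' k) * (?Z k * m) = (p * ?X k - (real n + 1) * ?Y k) * (?Z k * m)"
      by simp
    then show ?thesis
      by (simp add: algebra_simps)
  qed
  then show ?thesis
    unfolding u_times_jacobi_form v_times_jacobi_form jacobi_form_Suc sum_distrib_left
      sum_subtractf[symmetric]
    by (intro sum.cong refl) simp
qed

text \<open>
  The relation for the inner cut, whose variables add up to the second variable of the outer one;
  this is why the factor \<open>u + v\<close> has to appear. In the usual normalization it expresses
  \<open>(1 + t) P\<^sub>n\<close> with parameters \<open>p, q\<close> through \<open>P\<^sub>n\<^sub>+\<^sub>1\<close> and \<open>P\<^sub>n\<close> with parameters \<open>p, q - 1\<close>.
\<close>
lemma jacobi_form_raise_inner: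
  "(2 * real n + p + q + 1) * (u * jacobi_form n p q u v) =
     (real n + 1) * jacobi_form (Suc n) p (q - 1) u v +
     ((real n + q) * (u * jacobi_form n p (q - 1) u v) + (real n + q) * (v * jacobi_form n p (q - 1) u v))"
proof -
  let ?X = "gchoose_diff (real n + p) n" and ?Y' = "gchoose_diff (real n + (p + 1)) (Suc n)"
    and ?Y = "gchoose_diff (real n + p) (Suc n)" and ?Z = "\<lambda>k. (real n + q) gchoose k"
    and ?Z' = "\<lambda>k. (real n + (q - 1)) gchoose k"
  have "(2 * real n + p + q + 1) * (?X k * ?Z k * m) =
      (real n + 1) * (?Y' k * ?Z k * m) +
      ((real n + q) * (?X k * ?Z' k * m) + - (real k * ?Y k) * ?Z k * m)"
    if "k \<le> Suc n" for k m
  proof -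
    have Z': "(real n + q) * ?Z' k = (real n + q - real k) * ?Z k"
      using gbinomial_absorb_comp[of "real n + q" k] by (simp add: add_diff_eq)
    have Y': "?Y' k = ?Y k + ?X k"
      using gchoose_diff_Pascal[OF that, of "real n + p"] by (simp add: add.assoc)
    have "(2 * real n + p + q + 1) * ?X k =
        (real n + 1) * ?Y' k + (real n + q - real k) * ?X k - real k * ?Y k"
      unfolding Y' using gchoose_diff_step[OF that, of "real n + p"] by (simp add: algebra_simps)
    then have "(2 * real n + p + q + 1) * ?X k * (?Z k * m) =
        ((real n + 1) * ?Y' k + (real n + q - real k) * ?X k - real k * ?Y k) * (?Z k * m)"
      by simp
    also have "\<dots> = (real n + 1) * ?Y' k * (?Z k * m) + ((real n + q - real k) * ?Z k) * (?X k * m)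
        - real k * ?Y k * (?Z k * m)"
      by (simp add: algebra_simps)
    finally show ?thesis
      by (simp only: Z'[symmetric]) (simp add: algebra_simps)
  qed
  moreover have Suc_p: "jacobi_form (Suc n) p (q - 1) u v =
      (\<Sum>k\<le>Suc n. ?Y' k * ?Z k * (u ^ (Suc n - k) * (- v) ^ k))"
    using jacobi_form_Suc[of n "p + 1" q u v] by (simp only: add_diff_cancel_right')
  ultimately show ?thesis
    unfolding u_times_jacobi_form v_times_jacobi_form Suc_p
      sum_distrib_left sum.distrib[symmetric]
    by (intro sum.cong refl) simp
qed

section \<open>Derivatives of a single form and the ladder for two\<close>

lemma powr_split:
  fixes u :: real
  shows "u > 0 \<Longrightarrow> u powr q = u * u powr (q - 1)"
  by (simp add: powr_diff)

text \<open>
  The partial derivative of \<open>edge_form\<close> in its second variable: \<open>p + v \<partial>\<^sub>v\<close> multiplies the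
  \<open>k\<close>-th term by \<open>p + k\<close>, which turns \<open>H\<^sub>n\<close> into \<open>n + p\<close> times the form with \<open>p - 1\<close>.
\<close>
definition edge_form_dv :: "nat \<Rightarrow> real \<Rightarrow> real \<Rightarrow> real \<Rightarrow> real \<Rightarrow> real" where
  "edge_form_dv n p q u v = ((real n + p) * edge_form n (p - 1) q u v - p * edge_form n p q u v) / v"

text \<open>
  The chain rule, stated for a curve \<open>(U, V)\<close> because every partial derivative below moves the two
  variables of a cut in a different direction. It is proved term by term, since \<open>u\<^sup>q u\<^sup>n\<^sup>-\<^sup>k\<close> is again
  a power of \<open>u\<close> and its exponent is absorbed into the binomial.
\<close>
lemma edge_form_has_derivative:
  assumes U: "(U has_real_derivative U') (at t)" and V: "(V has_real_derivative V') (at t)"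
    and pos: "U t > 0" "V t \<noteq> 0"
  shows "((\<lambda>t. edge_form n p q (U t) (V t)) has_real_derivative
     U' * ((real n + q) * edge_form n p (q - 1) (U t) (V t)) +
     V' * edge_form_dv n p q (U t) (V t)) (at t)"
proof -
  let ?a = "\<lambda>p k. (real n + p) gchoose (n - k)" and ?b = "\<lambda>q k. (real n + q) gchoose k"
  have power: "((\<lambda>t. f t ^ m) has_real_derivative real m * f t ^ m / f t * f') (at t)"
    if "(f has_real_derivative f') (at t)" "f t \<noteq> 0" for f f' m
    using DERIV_power[OF that(1), of m] that(2) by (cases m) (simp_all add: mult_ac)
  have U_part: "((\<lambda>t. U t powr q * U t ^ j) has_real_derivative
      (q + real j) * (U t powr (q - 1) * U t ^ j) * U') (at t)" for j
  proof -
    have "q * U t powr (q - 1) * U' * U t ^ j + real j * U t ^ j / U t * U' * U t powr q =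
        (q + real j) * (U t powr (q - 1) * U t ^ j) * U'"
      unfolding powr_split[OF pos(1), of q] using pos(1) by (simp add: algebra_simps)
    then show ?thesis
      using DERIV_mult[OF DERIV_chain2[where f = "\<lambda>u. u powr q" and g = U,
          OF has_real_derivative_powr[OF pos(1)] U] power[OF U, of j]]
        pos(1) by simp
  qed
  have V_part: "((\<lambda>t. (- V t) ^ j) has_real_derivative real j * (- V t) ^ j * V' / V t) (at t)" for j
    using power[OF DERIV_minus[OF V], of j] pos(2) by simp
  have summand: "((\<lambda>t. U t powr q * (?a p k * ?b q k * U t ^ (n - k) * (- V t) ^ k)) has_real_derivative
     U' * ((real n + q) * (U t powr (q - 1) * (?a p k * ?b (q - 1) k * U t ^ (n - k) * (- V t) ^ k))) +
     V' * (((real n + p) * (U t powr q * (?a (p - 1) k * ?b q k * U t ^ (n - k) * (- V t) ^ k)) -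
           p * (U t powr q * (?a p k * ?b q k * U t ^ (n - k) * (- V t) ^ k))) / V t)) (at t)"
    if k: "k \<le> n" for k
  proof -
    have b: "(real n + q) * ?b (q - 1) k = (real n + q - real k) * ?b q k"
      using gbinomial_absorb_comp[of "real n + q" k] by (simp add: algebra_simps)
    have a: "(real n + p) * ?a (p - 1) k = (p + real k) * ?a p k"
      using gbinomial_absorb_comp[of "real n + p" "n - k"] k by (simp add: algebra_simps of_nat_diff)
    define X Y Z where "X = U t powr (q - 1) * U t ^ (n - k)" and "Y = U t powr q * U t ^ (n - k)"
      and "Z = (- V t) ^ k"
    have "((\<lambda>t. ?a p k * ?b q k * ((U t powr q * U t ^ (n - k)) * (- V t) ^ k)) has_real_derivative
        ?a p k * ?b q k * ((q + real (n - k)) * X * U' * Z + real k * Z * V' / V t * Y)) (at t)"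
      unfolding X_def Y_def Z_def by (intro DERIV_cmult DERIV_mult U_part V_part)
    moreover have "?a p k * ?b q k * ((q + real (n - k)) * X * U' * Z + real k * Z * V' / V t * Y) =
        ((real n + q - real k) * ?b q k) * (?a p k * X * U' * Z) +
        ((p + real k) * ?a p k - p * ?a p k) * (?b q k * Z * Y) * V' / V t"
      using k by (simp add: of_nat_diff algebra_simps)
    moreover have "\<dots> = U' * ((real n + q) * (?a p k * ?b (q - 1) k * (X * Z))) +
        V' * ((real n + p) * (?a (p - 1) k * ?b q k * (Y * Z)) - p * (?a p k * ?b q k * (Y * Z))) / V t"
      unfolding a[symmetric] b[symmetric] by (simp add: algebra_simps)
    ultimately show ?thesis
      by (simp add: X_def Y_def Z_def mult_ac)
  qed
  have "((\<lambda>t. edge_form n p q (U t) (V t)) has_real_derivative (\<Sum>k\<le>n.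
     U' * ((real n + q) * (U t powr (q - 1) * (?a p k * ?b (q - 1) k * U t ^ (n - k) * (- V t) ^ k))) +
     V' * (((real n + p) * (U t powr q * (?a (p - 1) k * ?b q k * U t ^ (n - k) * (- V t) ^ k)) -
           p * (U t powr q * (?a p k * ?b q k * U t ^ (n - k) * (- V t) ^ k))) / V t))) (at t)"
    unfolding edge_form_def jacobi_form_def sum_distrib_left[of "_ powr _"]
    by (intro DERIV_sum summand) simp
  then show ?thesis
    unfolding edge_form_dv_def
    by (simp only: edge_form_def jacobi_form_def sum.distrib sum_subtractf
        flip: sum_distrib_left sum_divide_distrib)
qed

lemma edge_form_raise_both:
  assumes "u > 0"
  shows "(real n + p) * edge_form n (p - 1) q u v - v * ((real n + q) * edge_form n p (q - 1) u v) =
    (real n + 1) * edge_form (Suc n) (p - 1) (q - 1) u v"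
  using arg_cong[OF jacobi_form_raise_both[of n p u q v], of "(*) (u powr (q - 1))"]
  unfolding edge_form_def powr_split[OF assms, of q]
  by (simp add: algebra_simps)

lemma edge_form_raise_outer:
  assumes "u > 0"
  shows "v * ((real n + q) * edge_form n (p + 1) (q - 1) u v) =
    p * edge_form n p q u v - (real n + 1) * edge_form (Suc n) (p - 1) (q - 1) u v"
  using arg_cong[OF jacobi_form_raise_outer[of n q v p u], of "(*) (u powr (q - 1))"]
  unfolding edge_form_def powr_split[OF assms, of q]
  by (simp add: algebra_simps)

lemma edge_form_raise_inner:
  assumes "u > 0"
  shows "(2 * real n + p + q + 1) * edge_form n p q u v =
    (real n + 1) * edge_form (Suc n) p (q - 1) u v +
    (real n + q) * (u + v) * edge_form n p (q - 1) u v"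
  using arg_cong[OF jacobi_form_raise_inner[of n p q u v], of "(*) (u powr (q - 1))"]
  unfolding edge_form_def powr_split[OF assms, of q]
  by (simp add: algebra_simps)

text \<open>
  The common core of the relations for \<open>\<partial>\<^sub>x - \<partial>\<^sub>y\<close> and \<open>\<partial>\<^sub>z - \<partial>\<^sub>y\<close>. Write \<open>f\<close> for the outer and \<open>g\<close> for the inner form; the left side
  is \<open>N ((\<partial>\<^sub>y - \<partial>\<^sub>s) f \<cdot> g - f \<cdot> \<partial>\<^sub>u g)\<close>. The inner relation rewrites \<open>N g\<close> and the outer one
  rewrites \<open>N f\<close>; both produce the mixed term \<open>s (\<partial>\<^sub>y - \<partial>\<^sub>s) f \<cdot> \<partial>\<^sub>u g\<close>, which cancels. This needs
  the first parameter of \<open>f\<close> to equal \<open>2m + p + q + 1\<close>.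
\<close>
lemma edge_form_ladder:
  assumes "u > 0" "y > 0" and s: "s = u + v" and N: "N = 2 * real m + p + q + 1"
  shows "N * ((real n + b) * edge_form n (N + 1) (b - 1) y s * edge_form m p q u v
      - edge_form n N b y s * ((real m + q) * edge_form m p (q - 1) u v)) =
    (real n + b) * (real m + 1) * edge_form n (N + 1) (b - 1) y s * edge_form (Suc m) p (q - 1) u v
    - (real n + 1) * (real m + q) * edge_form (Suc n) (N - 1) (b - 1) y s * edge_form m p (q - 1) u v"
proof -
  define E E' R' where "E = (real n + b) * edge_form n (N + 1) (b - 1) y s"
    and "E' = N * edge_form n N b y s" and "R' = (real m + q) * edge_form m p (q - 1) u v"
  have R: "N * edge_form m p q u v = (real m + 1) * edge_form (Suc m) p (q - 1) u v + s * R'"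
    using edge_form_raise_inner[OF assms(1), of m p q v] by (simp add: N R'_def s mult_ac)
  have Q: "(real n + 1) * edge_form (Suc n) (N - 1) (b - 1) y s = E' - s * E"
    using edge_form_raise_outer[OF assms(2), of s n b N] by (simp add: E_def E'_def)
  have "N * (E * edge_form m p q u v - edge_form n N b y s * R') =
      E * (N * edge_form m p q u v) - E' * R'"
    by (simp add: E'_def algebra_simps)
  also have "\<dots> = E * ((real m + 1) * edge_form (Suc m) p (q - 1) u v) - (E' - s * E) * R'"
    unfolding R by (simp add: algebra_simps)
  finally show ?thesis
    unfolding Q[symmetric] by (simp add: E_def R'_def mult_ac)
qed

text \<open>
  Both contiguous relations with \<open>H\<^sub>n\<^sub>+\<^sub>1\<close> at \<open>p - 1, q - 1\<close> are needed: eliminating that form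
  from them leaves the single form of degree \<open>n\<close> on the right.
\<close>
lemma edge_form_has_derivative_antidiagonal:
  assumes U: "(U has_real_derivative 1) (at t)" and V: "(V has_real_derivative -1) (at t)"
    and pos: "U t > 0" "V t \<noteq> 0"
  shows "((\<lambda>t. edge_form n p q (U t) (V t)) has_real_derivative
     (real n + q) * edge_form n (p + 1) (q - 1) (U t) (V t)) (at t)"
proof -
  have "V t * ((real n + q) * edge_form n (p + 1) (q - 1) (U t) (V t)) =
      V t * ((real n + q) * edge_form n p (q - 1) (U t) (V t)) -
      ((real n + p) * edge_form n (p - 1) q (U t) (V t) - p * edge_form n p q (U t) (V t))"
    using edge_form_raise_both[OF pos(1), of n p q "V t"]
      edge_form_raise_outer[OF pos(1), of "V t" n q p] by linarith
  then have "(real n + q) * edge_form n (p + 1) (q - 1) (U t) (V t) =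
      1 * ((real n + q) * edge_form n p (q - 1) (U t) (V t)) +
      -1 * edge_form_dv n p q (U t) (V t)"
    using pos(2) by (simp add: edge_form_dv_def field_simps)
  then show ?thesis
    using edge_form_has_derivative[OF U V pos, of n p q] by (simp only:)
qed

text \<open>
  The Rodrigues step: with both weights attached the derivative is a single form of the next degree.
\<close>
lemma weighted_edge_form_has_derivative_antidiagonal:
  assumes U: "(U has_real_derivative 1) (at t)" and V: "(V has_real_derivative -1) (at t)"
    and pos: "U t > 0" "V t > 0"
  shows "((\<lambda>t. V t powr p * edge_form n p q (U t) (V t)) has_real_derivative
     - (real n + 1) * (V t powr (p - 1) * edge_form (Suc n) (p - 1) (q - 1) (U t) (V t))) (at t)"
proof -
  have "(real n + 1) * edge_form (Suc n) (p - 1) (q - 1) (U t) (V t) =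
      p * edge_form n p q (U t) (V t) - V t * ((real n + q) * edge_form n (p + 1) (q - 1) (U t) (V t))"
    using edge_form_raise_outer[OF pos(1), of "V t" n q p] by simp
  then have "V t powr (p - 1) * ((real n + 1) * edge_form (Suc n) (p - 1) (q - 1) (U t) (V t)) =
      V t powr (p - 1) * (p * edge_form n p q (U t) (V t) -
        V t * ((real n + q) * edge_form n (p + 1) (q - 1) (U t) (V t)))"
    by simp
  then have "- (real n + 1) * (V t powr (p - 1) * edge_form (Suc n) (p - 1) (q - 1) (U t) (V t)) =
      p * V t powr (p - 1) * -1 * edge_form n p q (U t) (V t) +
      V t powr p * ((real n + q) * edge_form n (p + 1) (q - 1) (U t) (V t))"
    unfolding powr_split[OF pos(2), of p] by (simp add: algebra_simps)
  then show ?thesis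
    using DERIV_mult[OF DERIV_chain2[where f = "\<lambda>v. v powr p" and g = V,
          OF has_real_derivative_powr[OF pos(2)] V]
        edge_form_has_derivative_antidiagonal[OF U V, of n p q]] pos
    by (simp add: mult_ac)
qed

section \<open>Jacobi polynomials as homogeneous forms\<close>

text \<open>
  On \<open>u = 1 + t\<close>, \<open>v = 1 - t\<close> the derivative in \<open>t\<close> is the antidiagonal one, so this is the
  Rodrigues step iterated, from a form of degree \<open>0\<close>.
\<close>
lemma higher_deriv_powr_powr_eq:
  assumes "t \<in> {-1<..<1}"
  shows "(deriv ^^ k) (\<lambda>s. (1 - s) powr a * (1 + s) powr b) t =
    (-1) ^ k * fact k * ((1 - t) powr (a - real k) * edge_form k (a - real k) (b - real k) (1 + t) (1 - t))"
  using assms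
proof (induction k arbitrary: t)
  case 0
  then show ?case
    by (simp add: edge_form_def jacobi_form_def)
next
  case (Suc k)
  let ?f = "\<lambda>s::real. (1 - s) powr a * (1 + s) powr b"
  have "((\<lambda>s. (-1) ^ k * fact k * ((1 - s) powr (a - real k) *
      edge_form k (a - real k) (b - real k) (1 + s) (1 - s))) has_real_derivative
      (-1) ^ k * fact k * (- (real k + 1) * ((1 - t) powr (a - real k - 1) *
        edge_form (Suc k) (a - real k - 1) (b - real k - 1) (1 + t) (1 - t)))) (at t)"
    by (intro DERIV_cmult weighted_edge_form_has_derivative_antidiagonal)
      (use Suc.prems in \<open>auto intro!: derivative_eq_intros\<close>)
  then have "((deriv ^^ k) ?f has_real_derivative
      (-1) ^ k * fact k * (- (real k + 1) * ((1 - t) powr (a - real k - 1) *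
        edge_form (Suc k) (a - real k - 1) (b - real k - 1) (1 + t) (1 - t)))) (at t)"
    by (rule has_field_derivative_transform_within_open[of _ _ _ "{-1<..<1}"])
      (use Suc in auto)
  then have "deriv ((deriv ^^ k) ?f) t =
      (-1) ^ k * fact k * (- (real k + 1) * ((1 - t) powr (a - real k - 1) *
        edge_form (Suc k) (a - real k - 1) (b - real k - 1) (1 + t) (1 - t)))"
    by (rule DERIV_imp_deriv)
  moreover have "(-1) ^ k * fact k * (- (real k + 1) * m) = (-1) ^ Suc k * fact (Suc k) * m" for m
    by (simp add: algebra_simps)
  moreover have "a - real k - 1 = a - real (Suc k)" "b - real k - 1 = b - real (Suc k)"
    by simp_all
  ultimately show ?case
    by (simp only: funpow.simps o_apply)
qed

lemma poly_jacobi_eq_jacobi_form: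
  assumes "-1 < t" "t < 1"
  shows "2 ^ n * poly (jacobi n p q) t = jacobi_form n p q (1 + t) (1 - t)"
proof -
  have "poly (jacobi n p q) t = (-1) ^ n / (2 ^ n * fact n) * (1 - t) powr (-p) * (1 + t) powr (-q) *
      ((-1) ^ n * fact n * ((1 - t) powr p * edge_form n p q (1 + t) (1 - t)))"
    using assms by (simp add: poly_jacobi jacobi_rodrigues_def higher_deriv_powr_powr_eq)
  also have "\<dots> = ((-1) ^ n * (-1) ^ n) / 2 ^ n * ((1 - t) powr (-p) * (1 - t) powr p) *
      ((1 + t) powr (-q) * (1 + t) powr q) * jacobi_form n p q (1 + t) (1 - t)"
    by (simp add: edge_form_def)
  also have "\<dots> = jacobi_form n p q (1 + t) (1 - t) / 2 ^ n"
    using assms by (simp add: powr_minus flip: power_add mult_2)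
  finally show ?thesis
    by simp
qed

text \<open>
  The point \<open>t = 2u/c - 1\<close> has \<open>1 + t = 2u/c\<close> and \<open>1 - t = 2v/c\<close>, so that homogeneity removes
  all denominators.
\<close>
lemma poly_jacobi_on_segment:
  assumes "0 < u" "0 < v" "u + v = c"
  shows "c ^ n * poly (jacobi n p q) (2 * u / c - 1) = jacobi_form n p q u v"
proof -
  have c: "c > 0" using assms by simp
  have "2 ^ n * poly (jacobi n p q) (2 * u / c - 1) = jacobi_form n p q (2 / c * u) (2 / c * v)"
  proof (subst poly_jacobi_eq_jacobi_form)
    have "1 + (2 * u / c - 1) = 2 / c * u" "1 - (2 * u / c - 1) = 2 / c * v"
      using c assms(3) by (auto simp: field_simps)
    then show "jacobi_form n p q (1 + (2 * u / c - 1)) (1 - (2 * u / c - 1)) =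
        jacobi_form n p q (2 / c * u) (2 / c * v)"
      by (simp only:)
  qed (use c assms in \<open>auto simp: field_simps\<close>)
  also have "\<dots> = 2 ^ n / c ^ n * jacobi_form n p q u v"
    by (simp only: jacobi_form_homogeneous power_divide)
  finally show ?thesis
    using c by (simp add: field_simps)
qed

section \<open>Weighted Koornwinder polynomials\<close>

text \<open>
  The three cuts, each with its share of the weight. Unlike \<open>weighted_koornwinder\<close> it has no
  quotients and its factors can be differentiated one at a time; the two agree on the simplex.
\<close>
definition koornwinder_weighted_form ::
  "nat \<Rightarrow> nat \<Rightarrow> nat \<Rightarrow> real \<Rightarrow> real \<Rightarrow> real \<Rightarrow> real \<Rightarrow> real \<Rightarrow> real \<Rightarrow> real \<Rightarrow> real" where
  "koornwinder_weighted_form n1 n2 n3 \<alpha> \<beta> \<gamma> \<delta> x y z =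
     edge_form n1 (\<beta> + \<gamma> + \<delta> + 2 * real n2 + 2 * real n3 + 2) \<alpha> x (1 - x) *
     edge_form n2 (\<gamma> + \<delta> + 2 * real n3 + 1) \<beta> y (1 - x - y) *
     ((1 - x - y - z) powr \<delta> * edge_form n3 \<delta> \<gamma> z (1 - x - y - z))"

lemma weighted_koornwinder_eq:
  assumes "(x, y, z) \<in> simplex3"
  shows "weighted_koornwinder n1 n2 n3 \<alpha> \<beta> \<gamma> \<delta> x y z =
    koornwinder_weighted_form n1 n2 n3 \<alpha> \<beta> \<gamma> \<delta> x y z"
proof -
  have pos: "0 < x" "0 < y" "0 < z" "0 < 1 - x - y - z"
    using assms by (auto simp: simplex3_def)
  define A B where "A = \<beta> + \<gamma> + \<delta> + 2 * real n2 + 2 * real n3 + 2" and "B = \<gamma> + \<delta> + 2 * real n3 + 1"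
  have "jacobi_form n1 A \<alpha> x (1 - x) = poly (jacobi n1 A \<alpha>) (2 * x - 1)"
    using poly_jacobi_on_segment[of x "1 - x" 1 n1 A \<alpha>] pos by simp
  moreover have "jacobi_form n2 B \<beta> y (1 - x - y) =
      (1 - x) ^ n2 * poly (jacobi n2 B \<beta>) (2 * y / (1 - x) - 1)"
    using poly_jacobi_on_segment[of y "1 - x - y" "1 - x" n2 B \<beta>] pos by simp
  moreover have "jacobi_form n3 \<delta> \<gamma> z (1 - x - y - z) =
      (1 - x - y) ^ n3 * poly (jacobi n3 \<delta> \<gamma>) (2 * z / (1 - x - y) - 1)"
    using poly_jacobi_on_segment[of z "1 - x - y - z" "1 - x - y" n3 \<delta> \<gamma>] pos by simp
  ultimately show ?thesis
    unfolding weighted_koornwinder_def koornwinder_weighted_form_def simplex_weight_def koornwinder_def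
      edge_form_def A_def[symmetric] B_def[symmetric]
    by (simp only: mult_ac)
qed

text \<open>
  For the last factor \<open>w\<^sup>\<delta> z\<^sup>\<gamma> H\<close>, with the derivative in \<open>w\<close> kept as one separate summand: it is
  common to the partial derivatives that are subtracted from each other, and will cancel.
\<close>
lemma weighted_edge_form_has_derivative:
  assumes U: "(U has_real_derivative U') (at t)" and V: "(V has_real_derivative V') (at t)"
    and pos: "U t > 0" "V t > 0"
  shows "((\<lambda>t. V t powr r * edge_form n p q (U t) (V t)) has_real_derivative
     U' * (V t powr r * ((real n + q) * edge_form n p (q - 1) (U t) (V t))) +
     V' * (r * V t powr (r - 1) * edge_form n p q (U t) (V t) + V t powr r * edge_form_dv n p q (U t) (V t)))
     (at t)"
proof -
  have "((\<lambda>t. V t powr r) has_real_derivative r * V t powr (r - 1) * V') (at t)"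
    using DERIV_chain2[where f = "\<lambda>v. v powr r" and g = V, OF has_real_derivative_powr[OF pos(2)] V] .
  from DERIV_mult[OF this edge_form_has_derivative[OF U V, of n p q]] show ?thesis
    using pos by (simp add: algebra_simps)
qed

text \<open>
  Only the last cut \<open>(z, w)\<close> depends on \<open>z\<close>. The parameters of the other two cuts contain
  \<open>n\<^sub>3\<close> only through \<open>\<gamma> + \<delta> + 2n\<^sub>3\<close>, which the step leaves unchanged.
\<close>
lemma koornwinder_weighted_form_dz:
  assumes "0 < z" "0 < 1 - x - y - z"
  shows "((\<lambda>s. koornwinder_weighted_form n1 n2 n3 \<alpha> \<beta> \<gamma> \<delta> x y s) has_real_derivative
    - (real n3 + 1) * koornwinder_weighted_form n1 n2 (n3 + 1) \<alpha> \<beta> (\<gamma> - 1) (\<delta> - 1) x y z) (at z)"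
proof -
  let ?E = "edge_form n1 (\<beta> + \<gamma> + \<delta> + 2 * real n2 + 2 * real n3 + 2) \<alpha> x (1 - x) *
    edge_form n2 (\<gamma> + \<delta> + 2 * real n3 + 1) \<beta> y (1 - x - y)"
  have "\<beta> + (\<gamma> - 1) + (\<delta> - 1) + 2 * real n2 + 2 * real (n3 + 1) + 2 =
      \<beta> + \<gamma> + \<delta> + 2 * real n2 + 2 * real n3 + 2"
    and "(\<gamma> - 1) + (\<delta> - 1) + 2 * real (n3 + 1) + 1 = \<gamma> + \<delta> + 2 * real n3 + 1"
    by simp_all
  then have "- (real n3 + 1) * koornwinder_weighted_form n1 n2 (n3 + 1) \<alpha> \<beta> (\<gamma> - 1) (\<delta> - 1) x y z =
      ?E * (- (real n3 + 1) * ((1 - x - y - z) powr (\<delta> - 1) *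
        edge_form (Suc n3) (\<delta> - 1) (\<gamma> - 1) z (1 - x - y - z)))"
    by (simp only: koornwinder_weighted_form_def Suc_eq_plus1 mult_ac)
  then show ?thesis
    unfolding koornwinder_weighted_form_def
    by (simp only:)
      (intro DERIV_cmult weighted_edge_form_has_derivative_antidiagonal,
        use assms in \<open>auto intro!: derivative_eq_intros\<close>)
qed

text \<open>
  The derivatives in \<open>1 - x - y\<close> (\<open>D2\<close>) and in \<open>w\<close> (\<open>D3\<close>) enter \<open>\<partial>\<^sub>x\<close> and \<open>\<partial>\<^sub>y\<close> alike and cancel. What
  remains is the ladder for the cuts \<open>(x, 1 - x)\<close> and \<open>(y, 1 - x - y)\<close>.
\<close>
lemma koornwinder_weighted_form_dx_dy:
  assumes "0 < x" "0 < y" "0 < z" "0 < 1 - x - y - z"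
  obtains Dx Dy where
    "((\<lambda>s. koornwinder_weighted_form n1 n2 n3 \<alpha> \<beta> \<gamma> \<delta> s y z) has_real_derivative Dx) (at x)"
    "((\<lambda>s. koornwinder_weighted_form n1 n2 n3 \<alpha> \<beta> \<gamma> \<delta> x s z) has_real_derivative Dy) (at y)"
    "(2 * real n2 + 2 * real n3 + \<beta> + \<gamma> + \<delta> + 2) * (Dx - Dy) =
       (real n1 + \<alpha>) * (real n2 + 1) *
         koornwinder_weighted_form n1 (n2 + 1) n3 (\<alpha> - 1) (\<beta> - 1) \<gamma> \<delta> x y z -
       (real n1 + 1) * (real n2 + \<beta>) *
         koornwinder_weighted_form (n1 + 1) n2 n3 (\<alpha> - 1) (\<beta> - 1) \<gamma> \<delta> x y z"
proof -
  define A B where "A = \<beta> + \<gamma> + \<delta> + 2 * real n2 + 2 * real n3 + 2" and "B = \<gamma> + \<delta> + 2 * real n3 + 1"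
  define v w where "v = 1 - x - y" and "w = 1 - x - y - z"
  define E1 E2 E3 where "E1 = edge_form n1 A \<alpha> x (1 - x)" and "E2 = edge_form n2 B \<beta> y v"
    and "E3 = w powr \<delta> * edge_form n3 \<delta> \<gamma> z w"
  define E1' E2' D2 D3 where "E1' = (real n1 + \<alpha>) * edge_form n1 (A + 1) (\<alpha> - 1) x (1 - x)"
    and "E2' = (real n2 + \<beta>) * edge_form n2 B (\<beta> - 1) y v" and "D2 = edge_form_dv n2 B \<beta> y v"
    and "D3 = \<delta> * w powr (\<delta> - 1) * edge_form n3 \<delta> \<gamma> z w + w powr \<delta> * edge_form_dv n3 \<delta> \<gamma> z w"
  have pos: "0 < 1 - x" "0 < v" "0 < w"
    using assms by (simp_all add: v_def w_def)
  have lin: "((\<lambda>s. 1 - s - y) has_real_derivative -1) (at x)"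
    "((\<lambda>s. 1 - s - y - z) has_real_derivative -1) (at x)"
    "((\<lambda>s. 1 - x - s) has_real_derivative -1) (at y)"
    "((\<lambda>s. 1 - x - s - z) has_real_derivative -1) (at y)"
    by (auto intro!: derivative_eq_intros)
  have "((\<lambda>s. edge_form n1 A \<alpha> s (1 - s)) has_real_derivative E1') (at x)"
    unfolding E1'_def by (rule edge_form_has_derivative_antidiagonal)
      (use assms pos in \<open>auto intro!: derivative_eq_intros\<close>)
  moreover have "((\<lambda>s. edge_form n2 B \<beta> y (1 - s - y)) has_real_derivative - D2) (at x)"
    using edge_form_has_derivative[OF DERIV_const lin(1), of y n2 B \<beta>] assms pos
    by (simp add: D2_def v_def)
  moreover have "((\<lambda>s. (1 - s - y - z) powr \<delta> * edge_form n3 \<delta> \<gamma> z (1 - s - y - z))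
      has_real_derivative - D3) (at x)"
    using weighted_edge_form_has_derivative[OF DERIV_const lin(2), of z \<delta> n3 \<delta> \<gamma>] assms pos
    by (simp add: D3_def w_def)
  ultimately have Dx: "((\<lambda>s. koornwinder_weighted_form n1 n2 n3 \<alpha> \<beta> \<gamma> \<delta> s y z) has_real_derivative
      (E1' * E2 + - D2 * E1) * E3 + - D3 * (E1 * E2)) (at x)"
    unfolding koornwinder_weighted_form_def A_def[symmetric] B_def[symmetric] E1_def E2_def E3_def v_def w_def
    by (intro DERIV_mult)
  have "((\<lambda>s. edge_form n2 B \<beta> s (1 - x - s)) has_real_derivative E2' - D2) (at y)"
    using edge_form_has_derivative[OF DERIV_ident lin(3), of n2 B \<beta>] assms pos
    by (simp add: D2_def E2'_def v_def)
  moreover have "((\<lambda>s. (1 - x - s - z) powr \<delta> * edge_form n3 \<delta> \<gamma> z (1 - x - s - z))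
      has_real_derivative - D3) (at y)"
    using weighted_edge_form_has_derivative[OF DERIV_const lin(4), of z \<delta> n3 \<delta> \<gamma>] assms pos
    by (simp add: D3_def w_def)
  ultimately have Dy: "((\<lambda>s. koornwinder_weighted_form n1 n2 n3 \<alpha> \<beta> \<gamma> \<delta> x s z) has_real_derivative
      E1 * (E2' - D2) * E3 + - D3 * (E1 * E2)) (at y)"
    unfolding koornwinder_weighted_form_def A_def[symmetric] B_def[symmetric] E1_def E2_def E3_def v_def w_def
    by (intro DERIV_mult DERIV_cmult)
  have A: "2 * real n2 + 2 * real n3 + \<beta> + \<gamma> + \<delta> + 2 = A" "A = 2 * real n2 + B + \<beta> + 1"
    by (simp_all add: A_def B_def)
  have "A * (((E1' * E2 + - D2 * E1) * E3 + - D3 * (E1 * E2)) - (E1 * (E2' - D2) * E3 + - D3 * (E1 * E2))) =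
      A * (E1' * E2 - E1 * E2') * E3"
    by (simp add: algebra_simps)
  also have "\<dots> = ((real n1 + \<alpha>) * (real n2 + 1) * edge_form n1 (A + 1) (\<alpha> - 1) x (1 - x) *
        edge_form (Suc n2) B (\<beta> - 1) y v
      - (real n1 + 1) * (real n2 + \<beta>) * edge_form (Suc n1) (A - 1) (\<alpha> - 1) x (1 - x) *
        edge_form n2 B (\<beta> - 1) y v) * E3"
    unfolding E1_def E2_def E1'_def E2'_def
    by (subst edge_form_ladder[where s = "1 - x"]) (use assms A in \<open>simp_all add: v_def\<close>)
  also have "\<dots> = (real n1 + \<alpha>) * (real n2 + 1) *
         koornwinder_weighted_form n1 (n2 + 1) n3 (\<alpha> - 1) (\<beta> - 1) \<gamma> \<delta> x y z -
       (real n1 + 1) * (real n2 + \<beta>) *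
         koornwinder_weighted_form (n1 + 1) n2 n3 (\<alpha> - 1) (\<beta> - 1) \<gamma> \<delta> x y z"
  proof -
    have "(\<beta> - 1) + \<gamma> + \<delta> + 2 * real (n2 + 1) + 2 * real n3 + 2 = A + 1"
      "(\<beta> - 1) + \<gamma> + \<delta> + 2 * real n2 + 2 * real n3 + 2 = A - 1"
      by (simp_all add: A_def)
    moreover have wv: "v - z = w"
      by (simp add: v_def w_def)
    ultimately show ?thesis
      unfolding koornwinder_weighted_form_def B_def[symmetric] v_def[symmetric] wv
      by (simp only: E3_def Suc_eq_plus1 left_diff_distrib right_diff_distrib mult_ac)
  qed
  finally show ?thesis
    using that Dx Dy A by simp
qed

text \<open>
  Again the derivative \<open>D3\<close> in \<open>w\<close> cancels. The ladder is now that of the cuts \<open>(y, 1 - x - y)\<close> and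
  \<open>(z, w)\<close>; here \<open>\<partial>\<^sub>y\<close>, which moves the outer cut, is the subtracted one, and this reverses both signs.
\<close>
lemma koornwinder_weighted_form_dy_dz:
  assumes "0 < x" "0 < y" "0 < z" "0 < 1 - x - y - z"
  obtains Dy Dz where
    "((\<lambda>s. koornwinder_weighted_form n1 n2 n3 \<alpha> \<beta> \<gamma> \<delta> x s z) has_real_derivative Dy) (at y)"
    "((\<lambda>s. koornwinder_weighted_form n1 n2 n3 \<alpha> \<beta> \<gamma> \<delta> x y s) has_real_derivative Dz) (at z)"
    "(2 * real n3 + \<gamma> + \<delta> + 1) * (Dz - Dy) =
       - (real n2 + \<beta>) * (real n3 + 1) *
         koornwinder_weighted_form n1 n2 (n3 + 1) \<alpha> (\<beta> - 1) (\<gamma> - 1) \<delta> x y z +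
       (real n2 + 1) * (real n3 + \<gamma>) *
         koornwinder_weighted_form n1 (n2 + 1) n3 \<alpha> (\<beta> - 1) (\<gamma> - 1) \<delta> x y z"
proof -
  define A B where "A = \<beta> + \<gamma> + \<delta> + 2 * real n2 + 2 * real n3 + 2" and "B = \<gamma> + \<delta> + 2 * real n3 + 1"
  define v w where "v = 1 - x - y" and "w = 1 - x - y - z"
  define E1 E2 E3 where "E1 = edge_form n1 A \<alpha> x (1 - x)" and "E2 = edge_form n2 B \<beta> y v"
    and "E3 = edge_form n3 \<delta> \<gamma> z w"
  define E2' E3' D3 where "E2' = (real n2 + \<beta>) * edge_form n2 (B + 1) (\<beta> - 1) y v"
    and "E3' = (real n3 + \<gamma>) * edge_form n3 \<delta> (\<gamma> - 1) z w"
    and "D3 = \<delta> * w powr (\<delta> - 1) * edge_form n3 \<delta> \<gamma> z w + w powr \<delta> * edge_form_dv n3 \<delta> \<gamma> z w"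
  have pos: "0 < v" "0 < w"
    using assms by (simp_all add: v_def w_def)
  have lin: "((\<lambda>s. 1 - x - s - z) has_real_derivative -1) (at y)"
    "((\<lambda>s. 1 - x - y - s) has_real_derivative -1) (at z)"
    by (auto intro!: derivative_eq_intros)
  have "((\<lambda>s. edge_form n2 B \<beta> s (1 - x - s)) has_real_derivative E2') (at y)"
    unfolding E2'_def v_def by (rule edge_form_has_derivative_antidiagonal)
      (use assms in \<open>auto intro!: derivative_eq_intros\<close>)
  moreover have "((\<lambda>s. (1 - x - s - z) powr \<delta> * edge_form n3 \<delta> \<gamma> z (1 - x - s - z))
      has_real_derivative - D3) (at y)"
    using weighted_edge_form_has_derivative[OF DERIV_const lin(1), of z \<delta> n3 \<delta> \<gamma>] assms pos
    by (simp add: D3_def w_def)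
  ultimately have Dy: "((\<lambda>s. koornwinder_weighted_form n1 n2 n3 \<alpha> \<beta> \<gamma> \<delta> x s z) has_real_derivative
      E1 * E2' * (w powr \<delta> * E3) + - D3 * (E1 * E2)) (at y)"
    unfolding koornwinder_weighted_form_def A_def[symmetric] B_def[symmetric] E1_def E2_def E3_def v_def w_def
    by (intro DERIV_mult DERIV_cmult)
  have "((\<lambda>s. (1 - x - y - s) powr \<delta> * edge_form n3 \<delta> \<gamma> s (1 - x - y - s))
      has_real_derivative w powr \<delta> * E3' - D3) (at z)"
    using weighted_edge_form_has_derivative[OF DERIV_ident lin(2) assms(3,4), of \<delta> n3 \<delta> \<gamma>]
    unfolding D3_def E3'_def w_def by (simp only: mult_1_left mult_minus1 add_uminus_conv_diff)
  then have Dz: "((\<lambda>s. koornwinder_weighted_form n1 n2 n3 \<alpha> \<beta> \<gamma> \<delta> x y s) has_real_derivative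
      E1 * E2 * (w powr \<delta> * E3' - D3)) (at z)"
    unfolding koornwinder_weighted_form_def A_def[symmetric] B_def[symmetric] E1_def E2_def v_def
    by (intro DERIV_cmult)
  have B: "2 * real n3 + \<gamma> + \<delta> + 1 = B" "B = 2 * real n3 + \<delta> + \<gamma> + 1"
    by (simp_all add: B_def)
  have "B * (E1 * E2 * (w powr \<delta> * E3' - D3) - (E1 * E2' * (w powr \<delta> * E3) + - D3 * (E1 * E2))) =
      - (B * (E2' * E3 - E2 * E3')) * (E1 * w powr \<delta>)"
    by (simp add: algebra_simps)
  also have "\<dots> = - ((real n2 + \<beta>) * (real n3 + 1) * edge_form n2 (B + 1) (\<beta> - 1) y v *
        edge_form (Suc n3) \<delta> (\<gamma> - 1) z w
      - (real n2 + 1) * (real n3 + \<gamma>) * edge_form (Suc n2) (B - 1) (\<beta> - 1) y v *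
        edge_form n3 \<delta> (\<gamma> - 1) z w) * (E1 * w powr \<delta>)"
    unfolding E2_def E3_def E2'_def E3'_def
    by (subst edge_form_ladder[where s = v]) (use assms B in \<open>simp_all add: v_def w_def\<close>)
  also have "\<dots> = - (real n2 + \<beta>) * (real n3 + 1) *
         koornwinder_weighted_form n1 n2 (n3 + 1) \<alpha> (\<beta> - 1) (\<gamma> - 1) \<delta> x y z +
       (real n2 + 1) * (real n3 + \<gamma>) *
         koornwinder_weighted_form n1 (n2 + 1) n3 \<alpha> (\<beta> - 1) (\<gamma> - 1) \<delta> x y z"
  proof -
    have "(\<beta> - 1) + (\<gamma> - 1) + \<delta> + 2 * real n2 + 2 * real (n3 + 1) + 2 = A"
      "(\<beta> - 1) + (\<gamma> - 1) + \<delta> + 2 * real (n2 + 1) + 2 * real n3 + 2 = A"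
      "(\<gamma> - 1) + \<delta> + 2 * real (n3 + 1) + 1 = B + 1"
      "(\<gamma> - 1) + \<delta> + 2 * real n3 + 1 = B - 1"
      by (simp_all add: A_def B_def)
    moreover have wv: "v - z = w"
      by (simp add: v_def w_def)
    ultimately show ?thesis
      unfolding koornwinder_weighted_form_def v_def[symmetric] wv
      by (simp only: E1_def Suc_eq_plus1) (simp add: algebra_simps)
  qed
  finally show ?thesis
    using that Dy Dz B by simp
qed

text \<open>
  Since \<open>simplex3\<close> is open, the line through one of its points in a coordinate direction stays in it for a
  while, and there the quotient-free product may replace the weighted polynomial under \<open>deriv\<close>.
\<close>
lemma partial_x_weighted_koornwinder:
  assumes "(x, y, z) \<in> simplex3"
    and "((\<lambda>s. koornwinder_weighted_form n1 n2 n3 \<alpha> \<beta> \<gamma> \<delta> s y z) has_real_derivative D) (at x)"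
  shows "partial_x (weighted_koornwinder n1 n2 n3 \<alpha> \<beta> \<gamma> \<delta>) x y z = D"
  unfolding partial_x_def
  by (rule DERIV_imp_deriv, rule has_field_derivative_transform_within_open[OF assms(2), of "{0<..<1 - y - z}"])
    (use assms(1) in \<open>auto simp: simplex3_def weighted_koornwinder_eq\<close>)

lemma partial_y_weighted_koornwinder:
  assumes "(x, y, z) \<in> simplex3"
    and "((\<lambda>s. koornwinder_weighted_form n1 n2 n3 \<alpha> \<beta> \<gamma> \<delta> x s z) has_real_derivative D) (at y)"
  shows "partial_y (weighted_koornwinder n1 n2 n3 \<alpha> \<beta> \<gamma> \<delta>) x y z = D"
  unfolding partial_y_def
  by (rule DERIV_imp_deriv, rule has_field_derivative_transform_within_open[OF assms(2), of "{0<..<1 - x - z}"])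
    (use assms(1) in \<open>auto simp: simplex3_def weighted_koornwinder_eq\<close>)

lemma partial_z_weighted_koornwinder:
  assumes "(x, y, z) \<in> simplex3"
    and "((\<lambda>s. koornwinder_weighted_form n1 n2 n3 \<alpha> \<beta> \<gamma> \<delta> x y s) has_real_derivative D) (at z)"
  shows "partial_z (weighted_koornwinder n1 n2 n3 \<alpha> \<beta> \<gamma> \<delta>) x y z = D"
  unfolding partial_z_def
  by (rule DERIV_imp_deriv, rule has_field_derivative_transform_within_open[OF assms(2), of "{0<..<1 - x - y}"])
    (use assms(1) in \<open>auto simp: simplex3_def weighted_koornwinder_eq\<close>)

lemma koornwinder_relation_xy:
  assumes "(x, y, z) \<in> simplex3"
  shows "(2 * real n2 + 2 * real n3 + \<beta> + \<gamma> + \<delta> + 2) *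
      (partial_x (weighted_koornwinder n1 n2 n3 \<alpha> \<beta> \<gamma> \<delta>) x y z -
       partial_y (weighted_koornwinder n1 n2 n3 \<alpha> \<beta> \<gamma> \<delta>) x y z) =
    (real n1 + \<alpha>) * (real n2 + 1) *
      koornwinder_weighted_form n1 (n2 + 1) n3 (\<alpha> - 1) (\<beta> - 1) \<gamma> \<delta> x y z -
    (real n1 + 1) * (real n2 + \<beta>) *
      koornwinder_weighted_form (n1 + 1) n2 n3 (\<alpha> - 1) (\<beta> - 1) \<gamma> \<delta> x y z"
proof -
  have "0 < x" "0 < y" "0 < z" "0 < 1 - x - y - z"
    using assms by (auto simp: simplex3_def)
  from koornwinder_weighted_form_dx_dy[OF this, of n1 n2 n3 \<alpha> \<beta> \<gamma> \<delta>] show ?thesis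
    using partial_x_weighted_koornwinder[OF assms] partial_y_weighted_koornwinder[OF assms] by metis
qed

lemma koornwinder_relation_yz:
  assumes "(x, y, z) \<in> simplex3"
  shows "(2 * real n3 + \<gamma> + \<delta> + 1) *
      (partial_z (weighted_koornwinder n1 n2 n3 \<alpha> \<beta> \<gamma> \<delta>) x y z -
       partial_y (weighted_koornwinder n1 n2 n3 \<alpha> \<beta> \<gamma> \<delta>) x y z) =
    - (real n2 + \<beta>) * (real n3 + 1) *
      koornwinder_weighted_form n1 n2 (n3 + 1) \<alpha> (\<beta> - 1) (\<gamma> - 1) \<delta> x y z +
    (real n2 + 1) * (real n3 + \<gamma>) *
      koornwinder_weighted_form n1 (n2 + 1) n3 \<alpha> (\<beta> - 1) (\<gamma> - 1) \<delta> x y z"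
proof -
  have "0 < x" "0 < y" "0 < z" "0 < 1 - x - y - z"
    using assms by (auto simp: simplex3_def)
  from koornwinder_weighted_form_dy_dz[OF this, of n1 n2 n3 \<alpha> \<beta> \<gamma> \<delta>] show ?thesis
    using partial_y_weighted_koornwinder[OF assms] partial_z_weighted_koornwinder[OF assms] by metis
qed

text \<open>
  The relation for \<open>\<partial>\<^sub>x - \<partial>\<^sub>y\<close> holds on the whole simplex, so both of its sides may be differentiated in \<open>z\<close>.
  The value of \<open>\<partial>\<^sub>x F - \<partial>\<^sub>y F\<close> can be read off from it only when the constant factor
  on its left is nonzero; if that factor vanishes, so does the right-hand side of that relation near \<open>z\<close>, and with it its derivative.
\<close>
lemma koornwinder_relation_xy_z:
  fixes n1 n2 n3 :: nat and \<alpha> \<beta> \<gamma> \<delta> x y z :: real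
  assumes "(x, y, z) \<in> simplex3"
  defines "F \<equiv> weighted_koornwinder n1 n2 n3 \<alpha> \<beta> \<gamma> \<delta>"
  shows "(2 * real n2 + 2 * real n3 + \<beta> + \<gamma> + \<delta> + 2) *
      partial_z (\<lambda>x y z. partial_x F x y z - partial_y F x y z) x y z =
    - ((real n1 + \<alpha>) * (real n2 + 1) * (real n3 + 1) *
        koornwinder_weighted_form n1 (n2 + 1) (n3 + 1) (\<alpha> - 1) (\<beta> - 1) (\<gamma> - 1) (\<delta> - 1) x y z -
      (real n1 + 1) * (real n2 + \<beta>) * (real n3 + 1) *
        koornwinder_weighted_form (n1 + 1) n2 (n3 + 1) (\<alpha> - 1) (\<beta> - 1) (\<gamma> - 1) (\<delta> - 1) x y z)"
    (is "?A * _ = ?R")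
proof -
  define g where "g = (\<lambda>s. partial_x F x y s - partial_y F x y s)"
  define h where "h = (\<lambda>s.
    (real n1 + \<alpha>) * (real n2 + 1) *
      koornwinder_weighted_form n1 (n2 + 1) n3 (\<alpha> - 1) (\<beta> - 1) \<gamma> \<delta> x y s -
    (real n1 + 1) * (real n2 + \<beta>) *
      koornwinder_weighted_form (n1 + 1) n2 n3 (\<alpha> - 1) (\<beta> - 1) \<gamma> \<delta> x y s)"
  have z: "z \<in> {0<..<1 - x - y}" and pos: "0 < z" "0 < 1 - x - y - z"
    using assms by (auto simp: simplex3_def)
  have gh: "?A * g s = h s" if "s \<in> {0<..<1 - x - y}" for s
  proof -
    have "(x, y, s) \<in> simplex3"
      using assms that by (auto simp: simplex3_def)
    then show ?thesis
      unfolding g_def h_def F_def by (rule koornwinder_relation_xy)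
  qed
  have "(h has_real_derivative
      (real n1 + \<alpha>) * (real n2 + 1) * (- (real n3 + 1) *
        koornwinder_weighted_form n1 (n2 + 1) (n3 + 1) (\<alpha> - 1) (\<beta> - 1) (\<gamma> - 1) (\<delta> - 1) x y z) -
      (real n1 + 1) * (real n2 + \<beta>) * (- (real n3 + 1) *
        koornwinder_weighted_form (n1 + 1) n2 (n3 + 1) (\<alpha> - 1) (\<beta> - 1) (\<gamma> - 1) (\<delta> - 1) x y z)) (at z)"
    unfolding h_def by (intro DERIV_diff DERIV_cmult koornwinder_weighted_form_dz pos)
  then have h': "(h has_real_derivative ?R) (at z)"
    by (simp add: algebra_simps)
  have "?A * deriv g z = ?R"
  proof (cases "?A = 0")
    case True
    have "(h has_real_derivative 0) (at z)"
      by (rule has_field_derivative_transform_within_open[of "\<lambda>_. 0" _ _ "{0<..<1 - x - y}"])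
        (use z gh True in auto)
    then show ?thesis
      using h' True DERIV_unique by fastforce
  next
    case False
    have "(g has_real_derivative ?R / ?A) (at z)"
      by (rule has_field_derivative_transform_within_open[OF DERIV_cdivide[OF h', of ?A], of "{0<..<1 - x - y}"])
        (use z gh False in \<open>auto simp: field_simps\<close>)
    then show ?thesis
      using False by (simp add: DERIV_imp_deriv)
  qed
  then show ?thesis
    by (simp add: partial_z_def g_def)
qed

theorem corollary7:
  fixes n1 n2 n3 :: nat and \<alpha> \<beta> \<gamma> \<delta> x y z :: real
  assumes "(x, y, z) \<in> simplex3"
  shows "let F = weighted_koornwinder n1 n2 n3 \<alpha> \<beta> \<gamma> \<delta> in
    ((2 * real n2 + 2 * real n3 + \<beta> + \<gamma> + \<delta> + 2) * (partial_x F x y z - partial_y F x y z) =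
       simplex_weight (\<alpha> - 1) (\<beta> - 1) \<gamma> \<delta> x y z *
       ((real n1 + \<alpha>) * (real n2 + 1) *
          koornwinder n1 (n2 + 1) n3 (\<alpha> - 1) (\<beta> - 1) \<gamma> \<delta> x y z -
        (real n1 + 1) * (real n2 + \<beta>) *
          koornwinder (n1 + 1) n2 n3 (\<alpha> - 1) (\<beta> - 1) \<gamma> \<delta> x y z)) \<and>
    ((2 * real n3 + \<gamma> + \<delta> + 1) * (partial_z F x y z - partial_y F x y z) =
       simplex_weight \<alpha> (\<beta> - 1) (\<gamma> - 1) \<delta> x y z *
       (- (real n2 + \<beta>) * (real n3 + 1) *
          koornwinder n1 n2 (n3 + 1) \<alpha> (\<beta> - 1) (\<gamma> - 1) \<delta> x y z +
        (real n2 + 1) * (real n3 + \<gamma>) *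
          koornwinder n1 (n2 + 1) n3 \<alpha> (\<beta> - 1) (\<gamma> - 1) \<delta> x y z)) \<and>
    (partial_z F x y z =
       - simplex_weight \<alpha> \<beta> (\<gamma> - 1) (\<delta> - 1) x y z * (real n3 + 1) *
         koornwinder n1 n2 (n3 + 1) \<alpha> \<beta> (\<gamma> - 1) (\<delta> - 1) x y z) \<and>
    ((2 * real n2 + 2 * real n3 + \<beta> + \<gamma> + \<delta> + 2) *
       partial_z (\<lambda>x y z. partial_x F x y z - partial_y F x y z) x y z =
       - simplex_weight (\<alpha> - 1) (\<beta> - 1) (\<gamma> - 1) (\<delta> - 1) x y z *
       ((real n1 + \<alpha>) * (real n2 + 1) * (real n3 + 1) *
          koornwinder n1 (n2 + 1) (n3 + 1) (\<alpha> - 1) (\<beta> - 1) (\<gamma> - 1) (\<delta> - 1) x y z -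
        (real n1 + 1) * (real n2 + \<beta>) * (real n3 + 1) *
          koornwinder (n1 + 1) n2 (n3 + 1) (\<alpha> - 1) (\<beta> - 1) (\<gamma> - 1) (\<delta> - 1) x y z))"
proof -
  have w: "simplex_weight a b c d x y z * koornwinder m1 m2 m3 a b c d x y z =
      koornwinder_weighted_form m1 m2 m3 a b c d x y z" for a b c d m1 m2 m3
    using weighted_koornwinder_eq[OF assms] by (simp add: weighted_koornwinder_def)
  have weight_diff: "simplex_weight a b c d x y z *
      (r * koornwinder m1 m2 m3 a b c d x y z - r' * koornwinder m1' m2' m3' a b c d x y z) =
      r * koornwinder_weighted_form m1 m2 m3 a b c d x y z -
      r' * koornwinder_weighted_form m1' m2' m3' a b c d x y z"
    and weight_add: "simplex_weight a b c d x y z *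
      (r * koornwinder m1 m2 m3 a b c d x y z + r' * koornwinder m1' m2' m3' a b c d x y z) =
      r * koornwinder_weighted_form m1 m2 m3 a b c d x y z +
      r' * koornwinder_weighted_form m1' m2' m3' a b c d x y z"
    and weight_one: "- simplex_weight a b c d x y z * r * koornwinder m1 m2 m3 a b c d x y z =
      - r * koornwinder_weighted_form m1 m2 m3 a b c d x y z"
    for a b c d r r' m1 m2 m3 m1' m2' m3'
    unfolding w[symmetric] by (simp_all add: algebra_simps)
  have pos: "0 < z" "0 < 1 - x - y - z"
    using assms by (auto simp: simplex3_def)
  show ?thesis
    unfolding Let_def mult_minus_left[of "simplex_weight _ _ _ _ _ _ _" "_ - _"]
      weight_diff weight_add weight_one
    by (intro conjI koornwinder_relation_xy koornwinder_relation_yz koornwinder_relation_xy_z assms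
        partial_z_weighted_koornwinder koornwinder_weighted_form_dz pos)
qed

end
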